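(* Let $N=\{1,\dots,n\}$ be a set of agents and let $k_a,k_p$ be positive integers with $n\ge k_p+1$. Suppose each agent $i\in N$ submits a set $P_i=\{p_{i,1},\dots,p_{i,m_i}\}$ of $m_i\ge 1$ papers (the sets $P_i$ pairwise disjoint), with $m_i\cdot k_p\le k_a$ for every $i\in N$, and let $P=\bigcup_{i\in N}P_i$. For each $i\in N$ and $\ell\in[m_i]$ let $\sigma_{i,\ell}$ be a strict ranking of $N\setminus\{i\}$. Then there exists a valid assignment $R:N\times P\to\{0,1\}$ with the following property: for every choice of preference extensions $(\succcurlyeq_{i,\ell})_{i\in N,\ell\in[m_i]}$ and $(\succcurlyeq_i)_{i\in N}$ of $\vec\sigma=(\sigma_{i,\ell})$ that satisfy order separability and consistency, $R$ is in the core.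
   Context: Notation: $[q]=\{1,\dots,q\}$. For an assignment $R$ (a function $N'\times P'\to\{0,1\}$, where $R(i,j)=1$ means agent $i$ reviews paper $j$), let $R^a_i=\{j\in P' : R(i,j)=1\}$ and $R^p_j=\{i\in N' : R(i,j)=1\}$. Validity: An assignment $R:N\times P\to\{0,1\}$ is valid if (i) $|R^a_i|\le k_a$ for all $i\in N$; (ii) $|R^p_j|=k_p$ for all $j\in P$; and (iii) $R(i,p_{i,\ell})=0$ for all $i\in N$ and $\ell\in[m_i]$ (no agent reviews her own paper). A restricted assignment is given by a subset $N'\subseteq N$, subsets $P'_i\subseteq P_i$ for $i\in N'$, $P'=\bigcup_{i\in N'}P'_i$, and a map $\hat R:N'\times P'\to\{0,1\}$. It is valid if (i) $|\hat R^a_i|\le k_a$ for all $i\in N'$; (ii) $|\hat R^p_j|=k_p$ for all $j\in P'$; and (iii) no agent in $N'$ reviews any of her own papers. Preference extensions: For each $i\in N$ and $\ell\in[m_i]$, $\succcurlyeq_{i,\ell}$ is a complete preorder on subsets of $N\setminus\{i\}$ (the sets of reviewers for paper $p_{i,\ell}$), with strict part $\succ_{i,\ell}$. For each $i\in N$, $\succcurlyeq_i$ is a complete preorder on assignments (both the full valid assignments and the valid restricted assignments whose agent set contains $i$), with strict part $\succ_i$. Write $\sigma_{i,\ell}(i')$ for the position of $i'$ in $\sigma_{i,\ell}$; a smaller position means the reviewer is more preferred. Order separability: for every $i,\ell$ and all pairwise disjoint $S_1,S_2,S_3\subseteq N\setminus\{i\}$ with $|S_1|=|S_2|>0$, if $\sigma_{i,\ell}(i')<\sigma_{i,\ell}(i'')$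 for all $i'\in S_1$ and $i''\in S_2$, then $S_1\cup S_3\succ_{i,\ell}S_2\cup S_3$. Consistency: for every valid assignment $R$, every valid restricted assignment $\hat R$ over $N'\subseteq N$ and $P'=\bigcup_{i\in N'}P'_i$, and every agent $i^*\in N'$: if $R^p_{p_{i^*,\ell}}\succcurlyeq_{i^*,\ell}\hat R^p_{p_{i^*,\ell}}$ for every $p_{i^*,\ell}\in P'_{i^*}$, then $R\succcurlyeq_{i^*}\hat R$. Core: A valid assignment $R$ is in the core if there do not exist a nonempty $N'\subseteq N$, subsets $P'_i\subseteq P_i$ for $i\in N'$, and a valid restricted assignment $\hat R$ over $N'$ and $P'=\bigcup_{i\in N'}P'_i$ such that $\hat R\succ_i R$ for every $i\in N'$. *)

theory Defs
  imports Main
begin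

text \<open>Agents are the natural numbers 1..n.  Paper p_{i,l} is encoded as the pair (i,l),
  so P_i = {(i,l) | l in [m_i]} and the P_i are automatically pairwise disjoint.
  A (restricted) assignment is a triple (N', P', R) where R is a boolean matrix which is
  required to be False outside N' x P' (canonical representation).  A full assignment R
  is identified with the restricted assignment (N, P, R).\<close>

type_synonym paper = "nat \<times> nat"
type_synonym rassign = "nat set \<times> paper set \<times> (nat \<Rightarrow> paper \<Rightarrow> bool)"

definition agents :: "nat \<Rightarrow> nat set" where
  "agents n = {1..n}"

definition papers_of :: "(nat \<Rightarrow> nat) \<Rightarrow> nat \<Rightarrow> paper set" where
  "papers_of m i = {(i, l) | l. l \<in> {1..m i}}"

definition all_papers :: "nat \<Rightarrow> (nat \<Rightarrow> nat) \<Rightarrow> paper set" where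
  "all_papers n m = (\<Union>i\<in>agents n. papers_of m i)"

definition valid_assign ::
  "nat \<Rightarrow> (nat \<Rightarrow> nat) \<Rightarrow> nat \<Rightarrow> nat \<Rightarrow> (nat \<Rightarrow> paper \<Rightarrow> bool) \<Rightarrow> bool" where
  "valid_assign n m ka kp R \<longleftrightarrow>
     (\<forall>i j. R i j \<longrightarrow> i \<in> agents n \<and> j \<in> all_papers n m) \<and>
     (\<forall>i\<in>agents n. card {j \<in> all_papers n m. R i j} \<le> ka) \<and>
     (\<forall>j\<in>all_papers n m. card {i \<in> agents n. R i j} = kp) \<and>
     (\<forall>i\<in>agents n. \<forall>l\<in>{1..m i}. \<not> R i (i, l))"

definition valid_restricted ::
  "nat \<Rightarrow> (nat \<Rightarrow> nat) \<Rightarrow> nat \<Rightarrow> nat \<Rightarrow> nat set \<Rightarrow> paper set \<Rightarrow> (nat \<Rightarrow> paper \<Rightarrow> bool) \<Rightarrow> bool" where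
  "valid_restricted n m ka kp N' P' Rh \<longleftrightarrow>
     N' \<subseteq> agents n \<and> P' \<subseteq> (\<Union>i\<in>N'. papers_of m i) \<and>
     (\<forall>i j. Rh i j \<longrightarrow> i \<in> N' \<and> j \<in> P') \<and>
     (\<forall>i\<in>N'. card {j \<in> P'. Rh i j} \<le> ka) \<and>
     (\<forall>j\<in>P'. card {i \<in> N'. Rh i j} = kp) \<and>
     (\<forall>i\<in>N'. \<forall>l\<in>{1..m i}. \<not> Rh i (i, l))"

definition full_as_restricted :: "nat \<Rightarrow> (nat \<Rightarrow> nat) \<Rightarrow> (nat \<Rightarrow> paper \<Rightarrow> bool) \<Rightarrow> rassign" where
  "full_as_restricted n m R = (agents n, all_papers n m, R)"

definition complete_preorder_on :: "'a set \<Rightarrow> ('a \<Rightarrow> 'a \<Rightarrow> bool) \<Rightarrow> bool" where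
  "complete_preorder_on S r \<longleftrightarrow>
     (\<forall>x\<in>S. r x x) \<and>
     (\<forall>x\<in>S. \<forall>y\<in>S. \<forall>z\<in>S. r x y \<longrightarrow> r y z \<longrightarrow> r x z) \<and>
     (\<forall>x\<in>S. \<forall>y\<in>S. r x y \<or> r y x)"

definition strict_part :: "('a \<Rightarrow> 'a \<Rightarrow> bool) \<Rightarrow> 'a \<Rightarrow> 'a \<Rightarrow> bool" where
  "strict_part r x y \<longleftrightarrow> r x y \<and> \<not> r y x"

definition is_extension ::
  "nat \<Rightarrow> (nat \<Rightarrow> nat) \<Rightarrow> nat \<Rightarrow> nat \<Rightarrow>
   (nat \<Rightarrow> nat \<Rightarrow> nat set \<Rightarrow> nat set \<Rightarrow> bool) \<Rightarrow> (nat \<Rightarrow> rassign \<Rightarrow> rassign \<Rightarrow> bool) \<Rightarrow> bool" where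
  "is_extension n m ka kp prefp prefa \<longleftrightarrow>
     (\<forall>i\<in>agents n. \<forall>l\<in>{1..m i}. complete_preorder_on (Pow (agents n - {i})) (prefp i l)) \<and>
     (\<forall>i\<in>agents n. complete_preorder_on
        {(N', P', Rh). valid_restricted n m ka kp N' P' Rh \<and> i \<in> N'} (prefa i))"

definition order_separable ::
  "nat \<Rightarrow> (nat \<Rightarrow> nat) \<Rightarrow> (nat \<Rightarrow> nat \<Rightarrow> nat \<Rightarrow> nat) \<Rightarrow> (nat \<Rightarrow> nat \<Rightarrow> nat set \<Rightarrow> nat set \<Rightarrow> bool) \<Rightarrow> bool" where
  "order_separable n m \<sigma> prefp \<longleftrightarrow>
     (\<forall>i\<in>agents n. \<forall>l\<in>{1..m i}. \<forall>S1 S2 S3.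
        S1 \<subseteq> agents n - {i} \<and> S2 \<subseteq> agents n - {i} \<and> S3 \<subseteq> agents n - {i} \<and>
        S1 \<inter> S2 = {} \<and> S1 \<inter> S3 = {} \<and> S2 \<inter> S3 = {} \<and>
        card S1 = card S2 \<and> card S1 > 0 \<and>
        (\<forall>a\<in>S1. \<forall>b\<in>S2. \<sigma> i l a < \<sigma> i l b)
        \<longrightarrow> strict_part (prefp i l) (S1 \<union> S3) (S2 \<union> S3))"

definition consistent ::
  "nat \<Rightarrow> (nat \<Rightarrow> nat) \<Rightarrow> nat \<Rightarrow> nat \<Rightarrow>
   (nat \<Rightarrow> nat \<Rightarrow> nat set \<Rightarrow> nat set \<Rightarrow> bool) \<Rightarrow> (nat \<Rightarrow> rassign \<Rightarrow> rassign \<Rightarrow> bool) \<Rightarrow> bool" where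
  "consistent n m ka kp prefp prefa \<longleftrightarrow>
     (\<forall>R N' P' Rh. valid_assign n m ka kp R \<and> valid_restricted n m ka kp N' P' Rh \<longrightarrow>
        (\<forall>i\<in>N'. (\<forall>l. (i, l) \<in> P' \<longrightarrow>
                     prefp i l {r \<in> agents n. R r (i, l)} {r \<in> N'. Rh r (i, l)})
                 \<longrightarrow> prefa i (full_as_restricted n m R) (N', P', Rh)))"

definition in_core ::
  "nat \<Rightarrow> (nat \<Rightarrow> nat) \<Rightarrow> nat \<Rightarrow> nat \<Rightarrow> (nat \<Rightarrow> rassign \<Rightarrow> rassign \<Rightarrow> bool) \<Rightarrow>
   (nat \<Rightarrow> paper \<Rightarrow> bool) \<Rightarrow> bool" where
  "in_core n m ka kp prefa R \<longleftrightarrow>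
     valid_assign n m ka kp R \<and>
     \<not> (\<exists>N' P' Rh. N' \<noteq> {} \<and> valid_restricted n m ka kp N' P' Rh \<and>
          (\<forall>i\<in>N'. strict_part (prefa i) (N', P', Rh) (full_as_restricted n m R)))"

end

theory Submission
  imports Defs
begin

text \<open>
  Padding with dummy papers, every agent may be assumed to have \<open>M = ka div kp\<close> papers, so that
  \<open>M * kp\<close> is both the number of reviews an agent needs and an admissible load.

  Top trading cycles: agents of an active set \<open>V\<close> point to the best member of \<open>V\<close> not yet reviewing
  one of their incomplete papers, and cycles are executed; agents whose papers are complete leave
  \<open>V\<close> one at a time. This is possible as long as \<open>V\<close> has more than \<open>kp\<close> members, and it is stopped
  when \<open>V\<close> has exactly \<open>kp + 1\<close> members, one of which, \<open>i\<^sub>0\<close>, is complete. The first member of a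
  coalition to leave \<open>V\<close> cannot improve within the coalition.

  The remaining gaps in the papers of this final set \<open>C\<close> are filled by exchanges which leave the
  papers of agents outside \<open>C\<close> untouched and, on the papers of \<open>i\<^sub>0\<close>, only replace a reviewer
  outside \<open>C\<close> by one in \<open>C\<close>. A coalition with a paper of its own has at least \<open>kp + 1\<close> members, so
  it either contains an agent outside \<open>C\<close>, or it equals \<open>C\<close>; in the latter case every paper of
  \<open>i\<^sub>0\<close> would be reviewed by \<open>C - {i\<^sub>0}\<close>, which is no improvement for \<open>i\<^sub>0\<close>.
\<close>

lemma exists_invariant_subset:
  assumes "finite V" "V \<noteq> {}" "f ` V \<subseteq> V"
  shows "\<exists>Z\<subseteq>V. Z \<noteq> {} \<and> f ` Z = Z"
proof -
  let ?Q = "\<lambda>Z. Z \<subseteq> V \<and> Z \<noteq> {} \<and> f ` Z \<subseteq> Z"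
  obtain Z where Z: "?Q Z" and min: "\<And>Y. ?Q Y \<Longrightarrow> card Z \<le> card Y"
    using ex_has_least_nat[of ?Q V card] assms by blast
  have "?Q (f ` Z)" using Z by blast
  then have "card Z \<le> card (f ` Z)" by (rule min)
  then have "f ` Z = Z"
    using Z assms(1) by (meson card_seteq finite_subset)
  then show ?thesis using Z by blast
qed

locale reviewing =
  fixes N :: "'a set" and k M :: nat and rk :: "'a \<times> nat \<Rightarrow> 'a \<Rightarrow> nat"
  assumes finite_N: "finite N" and card_N: "k + 1 \<le> card N"
    and inj_rk: "\<And>j. j \<in> N \<times> {1..M} \<Longrightarrow> inj_on (rk j) (N - {fst j})"
begin

abbreviation P :: "('a \<times> nat) set" where "P \<equiv> N \<times> {1..M}"

definition partial_review :: "('a \<times> nat \<Rightarrow> 'a set) \<Rightarrow> bool" where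
  "partial_review R \<longleftrightarrow> (\<forall>j\<in>P. R j \<subseteq> N - {fst j} \<and> card (R j) \<le> k)"

definition load :: "('a \<times> nat \<Rightarrow> 'a set) \<Rightarrow> 'a \<Rightarrow> nat" where
  "load R r = card {j \<in> P. r \<in> R j}"

definition complete :: "('a \<times> nat \<Rightarrow> 'a set) \<Rightarrow> 'a \<Rightarrow> bool" where
  "complete R i \<longleftrightarrow> (\<forall>l\<in>{1..M}. card (R (i, l)) = k)"

definition beats :: "('a \<times> nat \<Rightarrow> 'a set) \<Rightarrow> 'a \<Rightarrow> 'a set \<Rightarrow> bool" where
  "beats R i V \<longleftrightarrow>
     (\<forall>l\<in>{1..M}. \<forall>a\<in>R (i, l). \<forall>b\<in>V - {i} - R (i, l). rk (i, l) a < rk (i, l) b)"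

definition trade_inv :: "('a \<times> nat \<Rightarrow> 'a set) \<Rightarrow> 'a set \<Rightarrow> bool" where
  "trade_inv R V \<longleftrightarrow> partial_review R \<and> V \<subseteq> N \<and> k + 1 \<le> card V \<and>
     (\<forall>i\<in>N - V. complete R i) \<and>
     (\<forall>i\<in>N. load R i = (\<Sum>l\<in>{1..M}. card (R (i, l)))) \<and>
     (\<forall>i\<in>V. beats R i V) \<and>
     (\<forall>S\<subseteq>N. \<not> S \<subseteq> V \<longrightarrow> (\<exists>i\<in>S - V. beats R i S))"

lemma finite_P: "finite P"
  using finite_N by simp

lemma partial_reviewD:
  assumes "partial_review R" "j \<in> P"
  shows "R j \<subseteq> N" "fst j \<notin> R j" "card (R j) \<le> k" "finite (R j)"
  using assms finite_N unfolding partial_review_def by (blast intro: finite_subset)+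

lemma load_eq_sum: "load R r = (\<Sum>j\<in>P. of_bool (r \<in> R j))"
  unfolding load_def using finite_P by (simp add: Int_def sum.If_cases of_bool_def)

lemma load_update:
  assumes "j \<in> P"
  shows "load (R(j := A)) x + of_bool (x \<in> R j) = load R x + of_bool (x \<in> A)"
proof -
  have "(\<Sum>p\<in>P - {j}. of_bool (x \<in> (R(j := A)) p)) = (\<Sum>p\<in>P - {j}. of_bool (x \<in> R p) :: nat)"
    by (rule sum.cong) auto
  then show ?thesis
    unfolding load_eq_sum sum.remove[OF finite_P assms] by simp
qed

lemma sum_load:
  assumes "partial_review R"
  shows "(\<Sum>r\<in>N. load R r) = (\<Sum>j\<in>P. card (R j))"
proof -
  have "(\<Sum>r\<in>N. load R r) = (\<Sum>j\<in>P. \<Sum>r\<in>N. of_bool (r \<in> R j))"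
    unfolding load_eq_sum by (rule sum.swap)
  also have "\<dots> = (\<Sum>j\<in>P. card (R j))"
  proof (rule sum.cong)
    fix j assume "j \<in> P"
    then have "N \<inter> R j = R j" using partial_reviewD(1)[OF assms] by blast
    then show "(\<Sum>r\<in>N. of_bool (r \<in> R j)) = card (R j)"
      using finite_N by (simp add: of_bool_def sum.If_cases)
  qed simp
  finally show ?thesis .
qed

lemma trade_inv_finite: "trade_inv R V \<Longrightarrow> finite V"
  using finite_N finite_subset unfolding trade_inv_def by metis

lemma trade_inv_init: "trade_inv (\<lambda>_. {}) N"
  using card_N by (simp add: trade_inv_def partial_review_def beats_def load_def)

lemma beats_mono: "beats R i V \<Longrightarrow> S \<subseteq> V \<Longrightarrow> beats R i S"
  unfolding beats_def by blast

lemma trade_inv_remove: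
  assumes inv: "trade_inv R V" and v: "v \<in> V" "complete R v" and cV: "k + 1 < card V"
  shows "trade_inv R (V - {v})"
proof -
  from inv have bt: "\<And>i. i \<in> V \<Longrightarrow> beats R i V"
    and dom: "\<And>S. S \<subseteq> N \<Longrightarrow> \<not> S \<subseteq> V \<Longrightarrow> \<exists>i\<in>S - V. beats R i S"
    unfolding trade_inv_def by blast+
  have "\<exists>i\<in>S - (V - {v}). beats R i S" if S: "S \<subseteq> N" "\<not> S \<subseteq> V - {v}" for S
  proof (cases "S \<subseteq> V")
    case True
    then have "beats R v S" using beats_mono[OF bt] v(1) by blast
    moreover have "v \<in> S" using True S(2) by blast
    ultimately show ?thesis by blast
  next
    case False
    then show ?thesis using dom[OF S(1)] by blast
  qed
  moreover have "\<forall>i\<in>V - {v}. beats R i (V - {v})"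
    using beats_mono[OF bt] by (meson DiffD1 Diff_subset)
  moreover have "k + 1 \<le> card (V - {v})" using cV v(1) trade_inv_finite[OF inv] by simp
  moreover have "\<forall>i\<in>N - (V - {v}). complete R i"
    using inv v(2) unfolding trade_inv_def by blast
  ultimately show ?thesis
    using inv unfolding trade_inv_def by auto
qed

lemma trade_cycle:
  assumes inv: "trade_inv R V" and inc: "\<forall>i\<in>V. \<not> complete R i"
  obtains R' z where "trade_inv R' V" "z \<in> N" "load R z < load R' z" "\<And>x. load R x \<le> load R' x"
proof -
  from inv have part: "partial_review R" and VN: "V \<subseteq> N" and cV: "k + 1 \<le> card V"
    and bal: "\<And>i. i \<in> N \<Longrightarrow> load R i = (\<Sum>l\<in>{1..M}. card (R (i, l)))"
    and bt: "\<And>i. i \<in> V \<Longrightarrow> beats R i V"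
    and cp: "\<And>i. i \<in> N - V \<Longrightarrow> complete R i"
    and dom: "\<And>S. S \<subseteq> N \<Longrightarrow> \<not> S \<subseteq> V \<Longrightarrow> \<exists>i\<in>S - V. beats R i S"
    unfolding trade_inv_def by blast+
  have fV: "finite V" using VN finite_N by (rule finite_subset)
  have "\<exists>l\<in>{1..M}. card (R (i, l)) < k" if "i \<in> V" for i
    using inc that partial_reviewD(3)[OF part] VN unfolding complete_def
    by (metis SigmaI le_neq_implies_less subsetD)
  then obtain g where g: "\<And>i. i \<in> V \<Longrightarrow> g i \<in> {1..M} \<and> card (R (i, g i)) < k" by metis
  have "\<exists>x\<in>V - {i} - R (i, g i). \<forall>y\<in>V - {i} - R (i, g i). rk (i, g i) x \<le> rk (i, g i) y"
    if i: "i \<in> V" for i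
  proof -
    have "card (R (i, g i)) < card (V - {i})" using g[OF i] cV i fV by simp linarith
    moreover have "finite (R (i, g i))"
      using g[OF i] i VN by (intro partial_reviewD(4)[OF part]) auto
    ultimately have "V - {i} - R (i, g i) \<noteq> {}"
      by (metis Diff_eq_empty_iff card_mono leD)
    then show ?thesis
      using fV ex_has_least_nat[of "\<lambda>x. x \<in> V - {i} - R (i, g i)" _ "rk (i, g i)"] by blast
  qed
  then obtain f where f: "\<And>i. i \<in> V \<Longrightarrow> f i \<in> V - {i} - R (i, g i)"
    and fmin: "\<And>i y. i \<in> V \<Longrightarrow> y \<in> V - {i} - R (i, g i) \<Longrightarrow> rk (i, g i) (f i) \<le> rk (i, g i) y"
    by metis
  have "V \<noteq> {}" using cV by auto
  then obtain Z where Z: "Z \<subseteq> V" "Z \<noteq> {}" "f ` Z = Z"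
    using exists_invariant_subset[OF fV, of f] f by blast
  have Z_f: "f i \<in> Z" if "i \<in> Z" for i using Z(3) that by (metis imageI)
  have Z_surj: "\<exists>i\<in>Z. f i = x" if "x \<in> Z" for x using Z(3) that by (metis imageE)
  have fZ: "finite Z" using Z fV by (blast intro: finite_subset)
  then have injZ: "inj_on f Z" using Z(3) by (simp add: eq_card_imp_inj_on)
  define R' where
    "R' = (\<lambda>j. if fst j \<in> Z \<and> snd j = g (fst j) then insert (f (fst j)) (R j) else R j)"
  have R'_Z: "R' (i, l) = (if i \<in> Z \<and> l = g i then insert (f i) (R (i, l)) else R (i, l))" for i l
    by (simp add: R'_def)
  have cardR': "card (R' (i, l)) = card (R (i, l)) + of_bool (i \<in> Z \<and> l = g i)"
    if "i \<in> N" "l \<in> {1..M}" for i l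
    using partial_reviewD(4)[OF part, of "(i, l)"] that f[of i] Z by (auto simp: R'_Z)
  have ld: "load R' x = load R x + of_bool (x \<in> Z)" for x
  proof -
    let ?A = "(\<lambda>i. (i, g i)) ` {i \<in> Z. f i = x}"
    have "{j \<in> P. x \<in> R' j} = {j \<in> P. x \<in> R j} \<union> ?A"
      using g Z VN by (auto simp: R'_def)
    moreover have "{j \<in> P. x \<in> R j} \<inter> ?A = {}"
      using f Z by auto
    moreover have "finite {j \<in> P. x \<in> R j}" using finite_P by simp
    moreover have "finite ?A" using fZ by simp
    ultimately have "load R' x = load R x + card ?A"
      unfolding load_def by (simp add: card_Un_disjoint)
    moreover have "card ?A = card {i \<in> Z. f i = x}"
      by (rule card_image) (auto simp: inj_on_def)
    moreover have "card {i \<in> Z. f i = x} = of_bool (x \<in> Z)"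
    proof (cases "x \<in> Z")
      case True
      then obtain i where i: "i \<in> Z" "f i = x" using Z_surj by blast
      then have "{i \<in> Z. f i = x} = {i}" using inj_onD[OF injZ] by blast
      then show ?thesis using True by simp
    next
      case False
      then have "{i \<in> Z. f i = x} = {}" using Z_f by blast
      then have "card {i \<in> Z. f i = x} = 0" by (simp only: card.empty)
      then show ?thesis using False by simp
    qed
    ultimately show ?thesis by simp
  qed
  have rec: "(\<Sum>l\<in>{1..M}. card (R' (i, l))) = (\<Sum>l\<in>{1..M}. card (R (i, l))) + of_bool (i \<in> Z)"
    if "i \<in> N" for i
  proof -
    have "(\<Sum>l\<in>{1..M}. card (R' (i, l)))
        = (\<Sum>l\<in>{1..M}. card (R (i, l)) + of_bool (i \<in> Z \<and> l = g i))"
      using cardR'[OF that] by (rule sum.cong[OF refl])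
    also have "\<dots> = (\<Sum>l\<in>{1..M}. card (R (i, l))) + (\<Sum>l\<in>{1..M}. of_bool (i \<in> Z \<and> l = g i))"
      by (rule sum.distrib)
    also have "(\<Sum>l\<in>{1..M}. of_bool (i \<in> Z \<and> l = g i)) = (of_bool (i \<in> Z) :: nat)"
      using g[of i] Z(1) by (cases "i \<in> Z") (auto simp: of_bool_def)
    finally show ?thesis .
  qed
  have part': "partial_review R'"
    unfolding partial_review_def
  proof (intro ballI conjI)
    fix j assume j: "j \<in> P"
    show "R' j \<subseteq> N - {fst j}"
      using partial_reviewD(1,2)[OF part j] f[of "fst j"] Z VN by (auto simp: R'_def)
    show "card (R' j) \<le> k"
    proof (cases "fst j \<in> Z \<and> snd j = g (fst j)")
      case True
      then have "card (R j) < k" using g[of "fst j"] Z(1) by (metis prod.collapse subsetD)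
      then show ?thesis 
        using True partial_reviewD(4)[OF part j] by (auto simp: R'_def card_insert_if)
    next
      case False
      then show ?thesis using partial_reviewD(3)[OF part j] by (auto simp: R'_def)
    qed
  qed
  have bt': "beats R' i V" if i: "i \<in> V" for i
    unfolding beats_def
  proof (intro ballI)
    fix l a b assume l: "l \<in> {1..M}" and a: "a \<in> R' (i, l)" and b: "b \<in> V - {i} - R' (i, l)"
    show "rk (i, l) a < rk (i, l) b"
    proof (cases "a \<in> R (i, l)")
      case True
      moreover have "b \<in> V - {i} - R (i, l)" using b by (auto simp: R'_Z split: if_splits)
      ultimately show ?thesis using bt[OF i] l unfolding beats_def by blast
    next
      case False
      then have z: "i \<in> Z" "l = g i" "a = f i" using a by (auto simp: R'_Z split: if_splits)
      then have b': "b \<in> V - {i} - R (i, g i)" "b \<noteq> f i" using b by (auto simp: R'_Z)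
      then have "rk (i, l) a \<le> rk (i, l) b" using fmin[OF i] z by simp
      moreover have "rk (i, l) a \<noteq> rk (i, l) b"
        using inj_rk[of "(i, l)"] b' z f[OF i] i VN l by (auto simp: inj_on_def)
      ultimately show ?thesis by simp
    qed
  qed
  have same: "R' (i, l) = R (i, l)" if "i \<notin> V" for i l
    using that Z by (auto simp: R'_Z)
  have cp': "\<forall>i\<in>N - V. complete R' i"
    using cp same unfolding complete_def by auto
  have dom': "\<exists>i\<in>S - V. beats R' i S" if "S \<subseteq> N" "\<not> S \<subseteq> V" for S
    using dom[OF that] same unfolding beats_def by auto
  have "trade_inv R' V"
    unfolding trade_inv_def using part' VN cV cp' bt' dom' ld rec bal by simp
  moreover obtain z where "z \<in> Z" using Z by blast
  ultimately show ?thesis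
    using that[of R' z] ld Z VN by auto
qed

lemma load_le:
  assumes "trade_inv R V" "i \<in> N"
  shows "load R i \<le> M * k"
proof -
  have "(\<Sum>l\<in>{1..M}. card (R (i, l))) \<le> (\<Sum>l\<in>{1..M}. k)"
    using assms partial_reviewD(3)[of R] unfolding trade_inv_def by (intro sum_mono) auto
  then show ?thesis using assms unfolding trade_inv_def by simp
qed

lemma trading_terminates:
  assumes "trade_inv R V"
  shows "\<exists>R V i\<^sub>0. trade_inv R V \<and> card V = k + 1 \<and> i\<^sub>0 \<in> V \<and> complete R i\<^sub>0"
  using assms
proof (induction "card V + (\<Sum>i\<in>N. M * k - load R i)" arbitrary: R V rule: less_induct)
  case less
  have fV: "finite V" using less.prems by (rule trade_inv_finite)
  show ?case
  proof (cases "\<exists>v\<in>V. complete R v")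
    case True
    then obtain v where v: "v \<in> V" "complete R v" by blast
    show ?thesis
    proof (cases "card V = k + 1")
      case True
      then show ?thesis using v less.prems by blast
    next
      case False
      then have "k + 1 < card V" using less.prems unfolding trade_inv_def by simp
      then have "trade_inv R (V - {v})" using less.prems v by (intro trade_inv_remove)
      moreover have "card (V - {v}) < card V" using v fV by (intro card_Diff1_less)
      ultimately show ?thesis using less.hyps[of "V - {v}" R] by simp
    qed
  next
    case False
    then obtain R' z where R': "trade_inv R' V" "z \<in> N" "load R z < load R' z"
      "\<And>x. load R x \<le> load R' x"
      using trade_cycle[OF less.prems] by metis
    have "(\<Sum>i\<in>N. M * k - load R' i) < (\<Sum>i\<in>N. M * k - load R i)"
    proof (rule sum_strict_mono_ex1)
      show "\<forall>x\<in>N. M * k - load R' x \<le> M * k - load R x"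
        using R'(4) by (simp add: diff_le_mono2)
      show "\<exists>a\<in>N. M * k - load R' a < M * k - load R a"
        using R'(2,3) load_le[OF R'(1,2)] by (intro bexI[of _ z]) auto
    qed (rule finite_N)
    then show ?thesis using less.hyps[of V R'] R'(1) by simp
  qed
qed

lemma augment:
  assumes part: "partial_review R" and j: "j \<in> P" "card (R j) < k"
    and j': "j' \<in> P" and r: "r \<in> N" "r \<noteq> fst j'" "r \<notin> R j'"
  obtains R' where "partial_review R'" "\<And>x. load R' x = load R x + of_bool (x = r)"
    "\<And>p. p \<noteq> j \<Longrightarrow> p \<noteq> j' \<Longrightarrow> R' p = R p"
proof -
  note found = that
  have add: thesis if p: "p \<in> P" "card (R p) < k" "r \<noteq> fst p" "r \<notin> R p" "p = j \<or> p = j'" for p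
  proof (rule found[of "R(p := insert r (R p))"])
    show "partial_review (R(p := insert r (R p)))"
      using part p r partial_reviewD[OF part p(1)] unfolding partial_review_def by auto
    show "load (R(p := insert r (R p))) x = load R x + of_bool (x = r)" for x
      using load_update[OF p(1), of R "insert r (R p)" x] p(4) by (cases "x \<in> R p") auto
  qed (use p in auto)
  show thesis
  proof (cases "card (R j') < k \<or> r \<noteq> fst j \<and> r \<notin> R j")
    case True
    then show thesis using add[of j] add[of j'] j j' r by blast
  next
    case False
    note Rj = partial_reviewD[OF part j(1)] and Rj' = partial_reviewD[OF part j']
    have c: "card (R j') = k" and rj: "r \<in> insert (fst j) (R j)" using False Rj'(3) by auto
    have "card (insert (fst j) (R j) - {r}) = card (R j)" using rj Rj(2,4) by simp
    then have "\<not> R j' \<subseteq> insert (fst j) (R j) - {r}"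
      using card_mono[of "insert (fst j) (R j) - {r}" "R j'"] c j(2) Rj(4) by auto
    then obtain s where s: "s \<in> R j'" "s \<noteq> fst j" "s \<notin> R j" using r(3) by blast
    have ne: "j \<noteq> j'" using c j(2) by auto
    have sr: "s \<noteq> r" using s(1) r(3) by blast
    let ?R1 = "R(j' := insert r (R j' - {s}))"
    let ?R2 = "?R1(j := insert s (R j))"
    show thesis
    proof (rule found[of ?R2])
      have "card (insert r (R j' - {s})) = k"
        using c s(1) r(3) Rj'(4) by (simp add: card.insert_remove card_Diff_singleton) 
           (metis Suc_pred card_gt_0_iff empty_iff)
      then show "partial_review ?R2"
        using part j j' r s ne Rj Rj' unfolding partial_review_def by auto
      show "load ?R2 x = load R x + of_bool (x = r)" for x
        using load_update[OF j', of R "insert r (R j' - {s})" x]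
          load_update[OF j(1), of ?R1 "insert s (R j)" x] s r(3) sr ne
        by (auto simp: of_bool_def split: if_splits)
    qed auto
  qed
qed

definition fill_inv ::
  "('a \<times> nat \<Rightarrow> 'a set) \<Rightarrow> 'a set \<Rightarrow> 'a \<Rightarrow> ('a \<times> nat \<Rightarrow> 'a set) \<Rightarrow> bool" where
  "fill_inv R0 C i\<^sub>0 R \<longleftrightarrow> partial_review R \<and> (\<forall>i\<in>N. load R i \<le> M * k) \<and>
     (\<forall>i\<in>N - C. load R i = M * k) \<and> (\<forall>i l. i \<notin> C \<longrightarrow> R (i, l) = R0 (i, l)) \<and>
     complete R i\<^sub>0 \<and>
     (\<forall>l\<in>{1..M}. \<forall>a\<in>R (i\<^sub>0, l) - C. \<forall>b\<in>C - {i\<^sub>0} - R (i\<^sub>0, l). rk (i\<^sub>0, l) a < rk (i\<^sub>0, l) b)"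

lemma fill_step:
  assumes inv: "fill_inv R0 C i\<^sub>0 R" and C: "C \<subseteq> N" "card C = k + 1" "i\<^sub>0 \<in> C"
    and cp0: "\<And>i. i \<in> N - C \<Longrightarrow> complete R0 i" and inc: "j \<in> P" "card (R j) \<noteq> k"
  obtains R' r where "fill_inv R0 C i\<^sub>0 R'" "r \<in> N" "load R r < M * k"
    "\<And>x. load R' x = load R x + of_bool (x = r)"
proof -
  from inv have part: "partial_review R" and ld: "\<And>i. i \<in> N \<Longrightarrow> load R i \<le> M * k"
    and ldX: "\<And>i. i \<in> N - C \<Longrightarrow> load R i = M * k"
    and same: "\<And>i l. i \<notin> C \<Longrightarrow> R (i, l) = R0 (i, l)"
    and cp: "complete R i\<^sub>0"
    and good: "\<And>l a b. l \<in> {1..M} \<Longrightarrow> a \<in> R (i\<^sub>0, l) - C \<Longrightarrow> b \<in> C - {i\<^sub>0} - R (i\<^sub>0, l)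
      \<Longrightarrow> rk (i\<^sub>0, l) a < rk (i\<^sub>0, l) b"
    unfolding fill_inv_def by blast+
  have fC: "finite C" using C finite_N by (blast intro: finite_subset)
  have jk: "card (R j) < k" using partial_reviewD(3)[OF part inc(1)] inc(2) by simp
  obtain i l where il: "j = (i, l)" "i \<in> N" "l \<in> {1..M}" using inc(1) by auto
  have iC: "i \<in> C"
  proof (rule ccontr)
    assume "i \<notin> C"
    then show False using cp0[of i] same[of i l] il inc(2) unfolding complete_def by auto
  qed
  have i0: "i \<noteq> i\<^sub>0" using cp il inc(2) unfolding complete_def by auto
  have "\<exists>r\<in>N. load R r < M * k"
  proof (rule ccontr)
    assume "\<not> ?thesis"
    then have "(\<Sum>r\<in>N. M * k) \<le> (\<Sum>r\<in>N. load R r)" by (intro sum_mono) (simp add: not_less)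
    also have "\<dots> = (\<Sum>p\<in>P. card (R p))" by (rule sum_load[OF part])
    also have "\<dots> < (\<Sum>p\<in>P. k)"
      using finite_P jk inc(1) partial_reviewD(3)[OF part] by (intro sum_strict_mono_ex1) auto
    finally show False by (simp add: card_cartesian_product mult.assoc)
  qed
  then obtain r where r: "r \<in> N" "load R r < M * k" by blast
  then have rC: "r \<in> C" using ldX[of r] by auto
  have full: "D \<times> {1..M} \<subseteq> {p \<in> P. x \<in> R p} \<Longrightarrow> card D * M \<le> load R x" for D x
    unfolding load_def using card_mono[of "{p \<in> P. x \<in> R p}" "D \<times> {1..M}"] finite_P
    by (simp add: card_cartesian_product)
  have "\<not> (C - {r}) \<times> {1..M} \<subseteq> {p \<in> P. r \<in> R p}"
    using full[of "C - {r}" r] r(2) C fC rC by (auto simp: mult.commute)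
  then obtain c q where c: "c \<in> C" "c \<noteq> r" "q \<in> {1..M}" "r \<notin> R (c, q)" using C(1) by blast
  have cP: "(c, q) \<in> P" using c C by auto
  have keep: "fill_inv R0 C i\<^sub>0 R'"
    if "partial_review R'" and l': "\<And>x. load R' x = load R x + of_bool (x = r)"
      and "\<And>p. fst p \<notin> C \<Longrightarrow> R' p = R p" "complete R' i\<^sub>0"
      "\<And>l a b. l \<in> {1..M} \<Longrightarrow> a \<in> R' (i\<^sub>0, l) - C \<Longrightarrow> b \<in> C - {i\<^sub>0} - R' (i\<^sub>0, l)
        \<Longrightarrow> rk (i\<^sub>0, l) a < rk (i\<^sub>0, l) b" for R'
    unfolding fill_inv_def using that same ldX ld r rC by (auto simp: l' Suc_le_eq of_bool_def)
  show thesis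
  proof (cases "c = i\<^sub>0")
    case False
    obtain R' where R': "partial_review R'" "\<And>x. load R' x = load R x + of_bool (x = r)"
      "\<And>p. p \<noteq> j \<Longrightarrow> p \<noteq> (c, q) \<Longrightarrow> R' p = R p"
      using augment[OF part inc(1) jk cP r(1)] c by auto
    have same': "R' (i\<^sub>0, l) = R (i\<^sub>0, l)" for l using R'(3) False iC i0 il by auto
    show thesis
    proof (rule that[of R' r])
      show "fill_inv R0 C i\<^sub>0 R'"
      proof (rule keep)
        show "R' p = R p" if "fst p \<notin> C" for p
        proof -
          have "p \<noteq> j" "p \<noteq> (c, q)" using that il iC c(1) by auto
          then show ?thesis by (rule R'(3))
        qed
      qed (use R' cp good in \<open>auto simp: same' complete_def\<close>)
    qed (use R' r in auto)
  next
    case True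
    have r0: "r \<noteq> i\<^sub>0" using True c by simp
    have ck: "card (R (i\<^sub>0, q)) = k" using cp c unfolding complete_def by simp
    have "\<not> R (i\<^sub>0, q) \<subseteq> C - {i\<^sub>0} - {r}"
    proof
      assume "R (i\<^sub>0, q) \<subseteq> C - {i\<^sub>0} - {r}"
      then have "k \<le> card (C - {i\<^sub>0} - {r})" using card_mono fC ck by (metis finite_Diff)
      moreover have "card (C - {i\<^sub>0} - {r}) < card (C - {i\<^sub>0})"
        using fC rC r0 by (intro card_Diff1_less) auto
      ultimately show False using C fC by simp
    qed
    then obtain y where y: "y \<in> R (i\<^sub>0, q)" "y \<notin> C"
      using c True partial_reviewD(2)[OF part cP] by auto
    have yN: "y \<in> N" using y partial_reviewD(1)[OF part cP] True by auto
    have "\<not> (C - {i\<^sub>0}) \<times> {1..M} \<subseteq> {p \<in> P. y \<in> R p}"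
    proof
      assume *: "(C - {i\<^sub>0}) \<times> {1..M} \<subseteq> {p \<in> P. y \<in> R p}"
      have "card (insert (i\<^sub>0, q) ((C - {i\<^sub>0}) \<times> {1..M})) \<le> load R y"
        unfolding load_def using * y(1) cP True finite_P by (intro card_mono) auto
      moreover have "card (insert (i\<^sub>0, q) ((C - {i\<^sub>0}) \<times> {1..M})) = Suc (k * M)"
        using fC C by (simp add: card_cartesian_product)
      ultimately show False using ld[OF yN] by (simp add: mult.commute)
    qed
    then obtain d t where d: "d \<in> C" "d \<noteq> i\<^sub>0" "t \<in> {1..M}" "y \<notin> R (d, t)" using C(1) by blast
    \<comment> \<open>\<open>r\<close> takes over the review of \<open>y\<close>, which then has a unit of load to spare in place of \<open>r\<close>.\<close>
    let ?A = "insert r (R (i\<^sub>0, q) - {y})"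
    define R1 where "R1 = R((i\<^sub>0, q) := ?A)"
    have ry: "r \<noteq> y" using rC y by auto
    have cA: "card ?A = k"
      using ck y(1) c(4) True partial_reviewD(4)[OF part cP]
      by (simp add: card_Diff_singleton) (metis Suc_pred card_gt_0_iff empty_iff)
    have part1: "partial_review R1"
      using part cA r(1) r0 partial_reviewD(1,2)[OF part cP] True
      unfolding partial_review_def R1_def by auto
    have R1j: "R1 j = R j" using iC i0 il by (simp add: R1_def)
    have R1d: "R1 (d, t) = R (d, t)" using d by (simp add: R1_def)
    have load1: "load R1 x + of_bool (x = y) = load R x + of_bool (x = r)" for x
    proof -
      have "load R1 x + of_bool (x \<in> R (i\<^sub>0, q)) = load R x + of_bool (x \<in> ?A)"
        using load_update[OF cP, of R ?A x] True by (simp only: R1_def)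
      moreover have "y \<in> R (i\<^sub>0, q)" "r \<notin> R (i\<^sub>0, q)" using y(1) c(4) True by auto
      ultimately show ?thesis
        using ry by (cases "x = y"; cases "x = r"; cases "x \<in> R (i\<^sub>0, q)") simp_all
    qed
    have dP: "(d, t) \<in> P" using d C(1) by auto
    have "y \<noteq> fst (d, t)" "y \<notin> R1 (d, t)" "card (R1 j) < k" using d y(2) R1d R1j jk by auto
    then obtain R' where R': "partial_review R'" "\<And>x. load R' x = load R1 x + of_bool (x = y)"
      "\<And>p. p \<noteq> j \<Longrightarrow> p \<noteq> (d, t) \<Longrightarrow> R' p = R1 p"
      using augment[OF part1 inc(1) _ dP yN] by blast
    have R'0: "R' (i\<^sub>0, l) = (if l = q then ?A else R (i\<^sub>0, l))" for l
      using R'(3) d iC i0 il by (auto simp: R1_def)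
    show thesis
    proof (rule that[of R' r])
      show "fill_inv R0 C i\<^sub>0 R'"
      proof (rule keep)
        show "R' p = R p" if "fst p \<notin> C" for p
        proof -
          have "p \<noteq> j" "p \<noteq> (d, t)" "p \<noteq> (i\<^sub>0, q)" using that il iC d(1) C(3) by auto
          then show ?thesis using R'(3)[of p] by (simp add: R1_def)
        qed
        show "complete R' i\<^sub>0" using cp cA by (simp add: complete_def R'0)
        show "rk (i\<^sub>0, l) a < rk (i\<^sub>0, l) b"
          if "l \<in> {1..M}" "a \<in> R' (i\<^sub>0, l) - C" "b \<in> C - {i\<^sub>0} - R' (i\<^sub>0, l)" for l a b
          using good[of l a b] that rC y by (auto simp: R'0 split: if_splits)
      qed (use R' load1 in auto)
    qed (use R' r load1 in auto)
  qed
qed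

lemma fill_terminates:
  assumes "fill_inv R0 C i\<^sub>0 R" and C: "C \<subseteq> N" "card C = k + 1" "i\<^sub>0 \<in> C"
    and cp0: "\<And>i. i \<in> N - C \<Longrightarrow> complete R0 i"
  shows "\<exists>R. fill_inv R0 C i\<^sub>0 R \<and> (\<forall>j\<in>P. card (R j) = k)"
  using assms(1)
proof (induction "\<Sum>i\<in>N. M * k - load R i" arbitrary: R rule: less_induct)
  case less
  show ?case
  proof (cases "\<forall>j\<in>P. card (R j) = k")
    case True
    then show ?thesis using less.prems by blast
  next
    case False
    then obtain j where "j \<in> P" "card (R j) \<noteq> k" by blast
    then obtain R' r where R': "fill_inv R0 C i\<^sub>0 R'" "r \<in> N" "load R r < M * k"
      "\<And>x. load R' x = load R x + of_bool (x = r)"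
      using fill_step[OF less.prems C cp0] by metis
    have "(\<Sum>i\<in>N. M * k - load R' i) < (\<Sum>i\<in>N. M * k - load R i)"
      using R' finite_N by (intro sum_strict_mono_ex1) auto
    then show ?thesis using less.hyps R'(1) by blast
  qed
qed

theorem exists_stable_review:
  "\<exists>R. (\<forall>j\<in>P. R j \<subseteq> N - {fst j} \<and> card (R j) = k) \<and>
       (\<forall>i\<in>N. card {j \<in> P. i \<in> R j} \<le> M * k) \<and>
       (\<forall>S\<subseteq>N. k + 1 \<le> card S \<longrightarrow>
          (\<exists>i\<in>S. \<forall>l\<in>{1..M}. \<forall>T\<subseteq>S - {i}. card T = k \<longrightarrow>
             (\<forall>a\<in>R (i, l) - T. \<forall>b\<in>T - R (i, l). rk (i, l) a < rk (i, l) b)))"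
proof -
  obtain R0 C i\<^sub>0 where inv: "trade_inv R0 C" and C: "card C = k + 1" "i\<^sub>0 \<in> C" "complete R0 i\<^sub>0"
    using trading_terminates[OF trade_inv_init] by blast
  from inv have part: "partial_review R0" and CN: "C \<subseteq> N"
    and cp: "\<And>i. i \<in> N - C \<Longrightarrow> complete R0 i"
    and bal: "\<And>i. i \<in> N \<Longrightarrow> load R0 i = (\<Sum>l\<in>{1..M}. card (R0 (i, l)))"
    and bt: "beats R0 i\<^sub>0 C"
    and dom: "\<And>S. S \<subseteq> N \<Longrightarrow> \<not> S \<subseteq> C \<Longrightarrow> \<exists>i\<in>S - C. beats R0 i S"
    using C unfolding trade_inv_def by blast+
  have fC: "finite C" using CN finite_N by (rule finite_subset)
  have "load R0 i = M * k" if "i \<in> N - C" for i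
    using bal[of i] cp[OF that] that by (simp add: complete_def)
  then have "fill_inv R0 C i\<^sub>0 R0"
    unfolding fill_inv_def using part load_le[OF inv] C(3) bt
    by (auto simp: beats_def)
  then obtain R where R: "fill_inv R0 C i\<^sub>0 R" "\<forall>j\<in>P. card (R j) = k"
    using fill_terminates[OF _ CN C(1,2) cp] by metis
  have "\<exists>i\<in>S. \<forall>l\<in>{1..M}. \<forall>T\<subseteq>S - {i}. card T = k \<longrightarrow>
             (\<forall>a\<in>R (i, l) - T. \<forall>b\<in>T - R (i, l). rk (i, l) a < rk (i, l) b)"
    if S: "S \<subseteq> N" "k + 1 \<le> card S" for S
  proof (cases "S \<subseteq> C")
    case False
    then obtain i where i: "i \<in> S" "i \<notin> C" "beats R0 i S" using dom S by blast
    then have "R (i, l) = R0 (i, l)" for l using R unfolding fill_inv_def by blast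
    then have "beats R i S" using i unfolding beats_def by simp
    then show ?thesis using i(1) unfolding beats_def by blast
  next
    case True
    then have SC: "S = C" using S(2) C(1) fC card_seteq by metis
    have "rk (i\<^sub>0, l) a < rk (i\<^sub>0, l) b"
      if l: "l \<in> {1..M}" and T: "T \<subseteq> S - {i\<^sub>0}" "card T = k" and ab: "a \<in> R (i\<^sub>0, l) - T" "b \<in> T - R (i\<^sub>0, l)"
      for l T a b
    proof -
      have T_eq: "T = C - {i\<^sub>0}"
        using T SC C fC by (intro card_seteq) auto
      have "i\<^sub>0 \<notin> R (i\<^sub>0, l)"
        using R(1) l C CN unfolding fill_inv_def partial_review_def by fastforce
      then have "a \<in> R (i\<^sub>0, l) - C" "b \<in> C - {i\<^sub>0} - R (i\<^sub>0, l)" using ab T_eq by auto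
      then show ?thesis using R(1) l unfolding fill_inv_def by blast
    qed
    then show ?thesis using SC C(2) by blast
  qed
  moreover have "\<forall>j\<in>P. R j \<subseteq> N - {fst j}" "\<forall>i\<in>N. card {j \<in> P. i \<in> R j} \<le> M * k"
    using R(1) unfolding fill_inv_def partial_review_def load_def by blast+
  ultimately show ?thesis using R(2) by (intro exI[of _ R]) blast
qed

end

lemma order_separable_weak:
  assumes ext: "is_extension n m ka kp prefp prefa" and sep: "order_separable n m \<sigma> prefp"
    and il: "i \<in> agents n" "l \<in> {1..m i}"
    and S: "S \<subseteq> agents n - {i}" and T: "T \<subseteq> agents n - {i}" and eq: "card S = card T"
    and dom: "\<forall>a\<in>S - T. \<forall>b\<in>T - S. \<sigma> i l a < \<sigma> i l b"
  shows "prefp i l S T"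
proof (cases "S - T = {}")
  have fin: "finite S" "finite T" using S T by (auto simp: agents_def intro: finite_subset)
  case True
  then have "S = T" using eq fin by (simp add: card_subset_eq)
  then show ?thesis
    using ext il T unfolding is_extension_def complete_preorder_on_def by blast
next
  have fin: "finite S" "finite T" using S T by (auto simp: agents_def intro: finite_subset)
  case False
  then have "card (S - T) > 0" using fin by (simp add: card_gt_0_iff)
  moreover have "card (S - T) = card (T - S)"
    using eq fin by (simp add: card_Diff_subset_Int Int_commute)
  moreover have "S - T \<subseteq> agents n - {i}" "T - S \<subseteq> agents n - {i}" "S \<inter> T \<subseteq> agents n - {i}"
    "(S - T) \<inter> (T - S) = {}" "(S - T) \<inter> (S \<inter> T) = {}" "(T - S) \<inter> (S \<inter> T) = {}"
    using S T by blast+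
  ultimately have "strict_part (prefp i l) (S - T \<union> S \<inter> T) (T - S \<union> S \<inter> T)"
    using sep il dom unfolding order_separable_def by blast
  moreover have "S - T \<union> S \<inter> T = S" "T - S \<union> S \<inter> T = T" by blast+
  ultimately show ?thesis unfolding strict_part_def by simp
qed

theorem mainTheorem1:
  fixes n ka kp :: nat and m :: "nat \<Rightarrow> nat" and \<sigma> :: "nat \<Rightarrow> nat \<Rightarrow> nat \<Rightarrow> nat"
  assumes "ka > 0" and "kp > 0" and "n \<ge> kp + 1"
    and "\<forall>i\<in>agents n. m i \<ge> 1 \<and> m i * kp \<le> ka"
    and "\<forall>i\<in>agents n. \<forall>l\<in>{1..m i}. bij_betw (\<sigma> i l) (agents n - {i}) {1..n - 1}"
  shows "\<exists>R. valid_assign n m ka kp R \<and>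
           (\<forall>prefp prefa. is_extension n m ka kp prefp prefa \<and> order_separable n m \<sigma> prefp \<and>
                consistent n m ka kp prefp prefa \<longrightarrow> in_core n m ka kp prefa R)"
proof -
  define M where "M = ka div kp"
  define rk where "rk = (\<lambda>(i, l). \<sigma> i (if l \<le> m i then l else 1))"
  have fin: "finite (agents n)" by (simp add: agents_def)
  interpret reviewing "agents n" kp M rk
  proof
    fix j assume j: "j \<in> agents n \<times> {1..M}"
    obtain i l where il: "j = (i, l)" by (cases j)
    have "(if l \<le> m i then l else 1) \<in> {1..m i}" using assms(4) j il by auto
    then show "inj_on (rk j) (agents n - {fst j})"
      using assms(5) j il unfolding rk_def by (auto simp: bij_betw_def)
  qed (use assms fin in \<open>auto simp: agents_def\<close>)
  obtain Q where Q: "\<forall>j\<in>P. Q j \<subseteq> agents n - {fst j} \<and> card (Q j) = kp"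
    and Qload: "\<forall>i\<in>agents n. card {j \<in> P. i \<in> Q j} \<le> M * kp"
    and Qdom: "\<forall>S\<subseteq>agents n. kp + 1 \<le> card S \<longrightarrow>
          (\<exists>i\<in>S. \<forall>l\<in>{1..M}. \<forall>T\<subseteq>S - {i}. card T = kp \<longrightarrow>
             (\<forall>a\<in>Q (i, l) - T. \<forall>b\<in>T - Q (i, l). rk (i, l) a < rk (i, l) b))"
    using exists_stable_review by blast
  have mM: "m i \<le> M" if "i \<in> agents n" for i
    using assms(2,4) that by (simp add: M_def less_eq_div_iff_mult_less_eq)
  have papers: "(i, l) \<in> all_papers n m \<longleftrightarrow> i \<in> agents n \<and> l \<in> {1..m i}" for i l
    by (auto simp: all_papers_def papers_of_def)
  have sub: "all_papers n m \<subseteq> P"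
    using papers mM by fastforce
  define R where "R = (\<lambda>r j. j \<in> all_papers n m \<and> r \<in> Q j)"
  have revs: "{r \<in> agents n. R r j} = Q j" if "j \<in> all_papers n m" for j
    using Q sub that unfolding R_def by blast
  have valid: "valid_assign n m ka kp R"
    unfolding valid_assign_def
  proof (intro conjI ballI)
    show "\<forall>i j. R i j \<longrightarrow> i \<in> agents n \<and> j \<in> all_papers n m"
      using Q sub unfolding R_def by blast
    fix i assume i: "i \<in> agents n"
    have "card {j \<in> all_papers n m. R i j} \<le> card {j \<in> P. i \<in> Q j}"
      using finite_P sub by (intro card_mono) (auto simp: R_def)
    also have "\<dots> \<le> M * kp" using Qload i by blast
    also have "\<dots> \<le> ka" by (simp add: M_def)
    finally show "card {j \<in> all_papers n m. R i j} \<le> ka" .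
    fix l show "\<not> R i (i, l)" using Q sub unfolding R_def by fastforce
  next
    fix j assume "j \<in> all_papers n m"
    then show "card {i \<in> agents n. R i j} = kp" using revs Q sub by auto
  qed
  have core: "in_core n m ka kp prefa R"
    if ext: "is_extension n m ka kp prefp prefa" and sep: "order_separable n m \<sigma> prefp"
      and con: "consistent n m ka kp prefp prefa" for prefp prefa
    unfolding in_core_def
  proof (intro conjI notI)
    assume "\<exists>N' P' Rh. N' \<noteq> {} \<and> valid_restricted n m ka kp N' P' Rh \<and>
          (\<forall>i\<in>N'. strict_part (prefa i) (N', P', Rh) (full_as_restricted n m R))"
    then obtain N' P' Rh where ne: "N' \<noteq> {}" and vr: "valid_restricted n m ka kp N' P' Rh"
      and str: "\<forall>i\<in>N'. strict_part (prefa i) (N', P', Rh) (full_as_restricted n m R)"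
      by blast
    from vr have N': "N' \<subseteq> agents n" and P': "P' \<subseteq> (\<Union>i\<in>N'. papers_of m i)"
      and kp: "\<And>j. j \<in> P' \<Longrightarrow> card {i \<in> N'. Rh i j} = kp"
      and own: "\<And>i l. i \<in> N' \<Longrightarrow> l \<in> {1..m i} \<Longrightarrow> \<not> Rh i (i, l)"
      unfolding valid_restricted_def by blast+
    have fN': "finite N'" using N' fin by (rule finite_subset)
    have P'D: "i \<in> N' \<and> l \<in> {1..m i}" if "(i, l) \<in> P'" for i l
      using P' that by (auto simp: papers_of_def)
    have T: "{r \<in> N'. Rh r (i, l)} \<subseteq> N' - {i}" if "(i, l) \<in> P'" for i l
      using own P'D[OF that] by blast
    have "\<exists>i\<in>N'. \<forall>l. (i, l) \<in> P' \<longrightarrow>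
        prefp i l {r \<in> agents n. R r (i, l)} {r \<in> N'. Rh r (i, l)}"
    proof (cases "P' = {}")
      case True
      then show ?thesis using ne by blast
    next
      case False
      then obtain i l where il: "(i, l) \<in> P'" by auto
      have "kp \<le> card (N' - {i})"
        using kp[OF il] card_mono[OF _ T[OF il]] fN' by simp
      then have "kp + 1 \<le> card N'"
        using P'D[OF il] fN' assms(2) by (simp add: card_Diff_singleton)
      from Qdom[rule_format, OF N' this] obtain i where i: "i \<in> N'" and idom: "\<forall>l\<in>{1..M}. \<forall>T\<subseteq>N' - {i}. card T = kp \<longrightarrow>
             (\<forall>a\<in>Q (i, l) - T. \<forall>b\<in>T - Q (i, l). rk (i, l) a < rk (i, l) b)"
        by (rule bexE) (intro that ballI allI impI; blast)
      have "prefp i l {r \<in> agents n. R r (i, l)} {r \<in> N'. Rh r (i, l)}" if l: "(i, l) \<in> P'" for l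
      proof -
        have lm: "l \<in> {1..m i}" and ia: "i \<in> agents n" using P'D[OF l] N' by auto
        then have ap: "(i, l) \<in> all_papers n m" by (simp add: papers)
        then have iP: "(i, l) \<in> P" using sub by blast
        have "\<forall>a\<in>Q (i, l) - {r \<in> N'. Rh r (i, l)}. \<forall>b\<in>{r \<in> N'. Rh r (i, l)} - Q (i, l).
            rk (i, l) a < rk (i, l) b"
          using idom iP T[OF l] kp[OF l] by blast
        then have "prefp i l (Q (i, l)) {r \<in> N'. Rh r (i, l)}"
          using Q iP T[OF l] kp[OF l] N' lm
          by (intro order_separable_weak[OF ext sep ia lm]) (auto simp: rk_def)
        then show ?thesis using revs[OF ap] by simp
      qed
      then show ?thesis using i by blast
    qed
    then obtain i where "i \<in> N'" "prefa i (full_as_restricted n m R) (N', P', Rh)"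
      using con valid vr unfolding consistent_def by blast
    then show False using str unfolding strict_part_def by blast
  qed (rule valid)
  show ?thesis using valid core by blast
qed

end
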